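(* Let $n \ge 5$ be an integer. Split the set of integers in $[F_n, F_{n+1})$ into the three subintervals $[F_n,\, F_n+F_{n-3}-2]$ (which is empty when $n=5$), $[F_n+F_{n-3}-1,\, F_n+F_{n-2}-1]$ and $[F_n+F_{n-2},\, F_{n+1}-1]$. Then the coefficients $a(m)$ of $A(x)=\prod_{k\ge 2}(1-x^{F_k})$ satisfy the following. (1) The numbers $a(F_n), a(F_n+1), \ldots, a(F_n+F_{n-3}-2)$ are equal to the numbers $(-1)^{n-1}a(F_{n-3}-2), (-1)^{n-1}a(F_{n-3}-3), \ldots, (-1)^{n-1}a(0)$, in that order; that is, $a(F_n+j) = (-1)^{n-1}a(F_{n-3}-2-j)$ for every integer $j$ with $0\le j\le F_{n-3}-2$. (2) The numbers $a(F_n+F_{n-3}-1), a(F_n+F_{n-3}), \ldots, a(F_n+F_{n-2}-1)$ are all equal to $0$; that is, $a(m)=0$ for every integer $m$ with $F_n+F_{n-3}-1\le m\le F_n+F_{n-2}-1$. (3) The numbers $a(F_n+F_{n-2}), a(F_n+F_{n-2}+1), \ldots, a(F_{n+1}-1)$ are equal to the numbers $a(0), a(1), \ldots, a(F_{n-3}-1)$, in that order; that is, $a(F_n+F_{n-2}+j)=a(j)$ for every integer $j$ with $0\le j\le F_{n-3}-1$.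
   Context: $F_k$ denotes the $k$-th Fibonacci number, with $F_1=F_2=1$ and $F_{k+1}=F_k+F_{k-1}$ (so $F_2=1$, $F_3=2$, $F_4=3$, $F_5=5$, $F_6=8$). $A(x)$ is the formal power series $A(x)=\prod_{k\ge 2}(1-x^{F_k}) = (1-x)(1-x^2)(1-x^3)(1-x^5)(1-x^8)\cdots$, and for each integer $m\ge 0$, $a(m)$ denotes the coefficient of $x^m$ in $A(x)$. *)

theory Defs
  imports
    "HOL-Analysis.Analysis"
    "HOL-Computational_Algebra.Formal_Power_Series"
    "HOL-Number_Theory.Fib"
begin

text \<open>
  The product over \<open>k \<ge> 2\<close> is indexed from 0 by a shift.
  Convergence is with respect to the usual metric on formal power series.
\<close>
definition fib_prod :: "int fps" where
  "fib_prod = (\<Prod>k. 1 - fps_X ^ fib (k + 2))"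

definition acoeff :: "nat \<Rightarrow> int" where
  "acoeff m = fps_nth fib_prod m"

text \<open>The infinite product converges, so \<^const>\<open>prodinf\<close> is not a junk value here.\<close>
lemma less_fib_add_4: "k < fib (k + 4)"
proof (induction k)
  case 0
  show ?case by (simp add: fib_neq_0_nat)
next
  case (Suc k)
  have "fib (Suc k + 4) = fib (k + 4) + fib (k + 3)"
    by (simp add: numeral_eq_Suc)
  moreover have "fib (k + 3) > 0"
    by (intro fib_neq_0_nat) simp
  ultimately show ?case
    using Suc by linarith
qed

lemma fib_prod_has_prod: "(\<lambda>k. 1 - fps_X ^ fib (k + 2)) has_prod fib_prod"
proof -
  define f :: "nat \<Rightarrow> int fps" where "f = (\<lambda>k. 1 - fps_X ^ fib (k + 2))"
  define P where "P = (\<lambda>n. \<Prod>i\<le>n. f i)"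
  have step: "fps_nth (P (Suc n)) m = fps_nth (P n) m" if "m < n" for n m
  proof -
    have "n \<le> fib (n + 3)"
      using less_fib_add_4[of "n - 1"] by (cases n) (auto simp: numeral_eq_Suc)
    hence "m < fib (n + 3)" using that by simp
    moreover have "P (Suc n) = P n - P n * fps_X ^ fib (n + 3)"
      by (simp add: P_def f_def algebra_simps numeral_eq_Suc)
    ultimately show ?thesis
      by (simp add: fps_mult_fps_X_power_nonzero fps_X_power_mult_right_nth)
  qed
  have const: "fps_nth (P n) m = fps_nth (P (Suc m)) m" if "n \<ge> Suc m" for n m
    using that by (induction n rule: dec_induct) (auto simp: step)
  define L where "L = Abs_fps (\<lambda>m. fps_nth (P (Suc m)) m)"
  have "P \<longlonglongrightarrow> L"
    unfolding tendsto_fps_iff L_def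
    by (auto intro!: eventually_sequentiallyI const)
  moreover have "fps_nth (P n) 0 = 1" for n
    by (induction n) (simp_all add: P_def f_def fib_neq_0_nat)
  hence "L \<noteq> 0"
    by (auto simp: L_def fps_eq_iff intro!: exI[of _ 0])
  ultimately have "f has_prod L"
    unfolding has_prod_def raw_has_prod_def P_def by simp
  moreover from this have "L = fib_prod"
    unfolding fib_prod_def f_def[symmetric] by (rule has_prod_unique)
  ultimately show ?thesis
    by (simp add: f_def)
qed

end

theory Submission
  imports Defs "HOL-Computational_Algebra.Polynomial_FPS"
begin

text \<open>
  Everything follows from two facts about the finite products
  \<open>A\<^sub>n = (1 - x\<^bsup>F\<^sub>2\<^esup>) \<cdots> (1 - x\<^bsup>F\<^sub>n\<^esup>)\<close>.
  Each factor changes only its sign when its coefficients are reversed, so \<open>A\<^sub>n\<close> is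
  palindromic up to the sign \<open>(-1)\<^bsup>n-1\<^esup>\<close> (\<open>reflect_fib_poly\<close>), and its degree is
  \<open>F\<^sub>2 + \<cdots> + F\<^sub>n = F\<^bsub>n+2\<^esub> - 2\<close>. Moreover \<open>a(m)\<close> is the coefficient of
  \<open>x\<^sup>m\<close> in \<open>A\<^sub>n\<close> as soon as \<open>m < F\<^bsub>n+1\<^esub>\<close>
  (\<open>acoeff_eq_coeff_fib_poly\<close>).

  Taking coefficients in \<open>A\<^sub>n = A\<^bsub>n-1\<^esub> - x\<^bsup>F\<^sub>n\<^esup> A\<^bsub>n-1\<^esub>\<close> and reflecting the
  first term back into the range where it is a coefficient of \<open>A\<close> gives, with
  \<open>a\<close> extended by zero to negative arguments, the recurrence
  \<open>a(F\<^sub>n + j) = (-1)\<^sup>n a(F\<^bsub>n-1\<^esub> - 2 - j) - a(j)\<close> for \<open>0 \<le> j < F\<^bsub>n-1\<^esub>\<close>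
  (\<open>acoeff_fib_add\<close>). The three parts of the theorem are consequences without induction:

  \<^item> In the first interval \<open>F\<^bsub>n-1\<^esub> - 2 - j = F\<^bsub>n-2\<^esub> + (F\<^bsub>n-3\<^esub> - 2 - j)\<close>, so the
    recurrence for \<open>n - 2\<close> expands the first term, and its contribution \<open>a(j)\<close> cancels.
  \<^item> In the middle interval both \<open>j\<close> and \<open>F\<^bsub>n-1\<^esub> - 2 - j\<close> are below \<open>F\<^bsub>n-2\<^esub>\<close>, where \<open>a\<close>
    agrees with the coefficients of \<open>A\<^bsub>n-3\<^esub>\<close>, of degree \<open>F\<^bsub>n-1\<^esub> - 2\<close>; its symmetry
    makes the two terms cancel.
  \<^item> In the last interval the recurrence is applied to \<open>F\<^bsub>n-2\<^esub> + j\<close>; its first term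
    \<open>(-1)\<^sup>n a(F\<^bsub>n-3\<^esub> - 2 - j)\<close> also occurs when \<open>a(F\<^bsub>n-2\<^esub> + j)\<close> is expanded by
    the recurrence for \<open>n - 2\<close>, and the two cancel.
\<close>

text \<open>With \<open>k\<close> factors, this is the product \<open>A\<^bsub>k+1\<^esub>\<close> of the introduction.\<close>
definition fib_poly :: "nat \<Rightarrow> int poly" where
  "fib_poly k = (\<Prod>i<k. 1 - monom 1 (fib (i + 2)))"

lemma fib_poly_Suc:
  "fib_poly (Suc k) = fib_poly k - monom 1 (fib (k + 2)) * fib_poly k"
  by (simp add: fib_poly_def algebra_simps)

lemma coeff_fib_poly_Suc:
  "coeff (fib_poly (Suc k)) m =
     coeff (fib_poly k) m - (if fib (k + 2) \<le> m then coeff (fib_poly k) (m - fib (k + 2)) else 0)"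
  by (simp only: fib_poly_Suc coeff_diff coeff_monom_mult) simp

lemma degree_one_minus_monom: "d > 0 \<Longrightarrow> degree (1 - monom 1 d :: int poly) = d"
  by (rule antisym; intro degree_le le_degree) (auto simp: coeff_1)

lemma reflect_poly_one_minus_monom:
  assumes "d > 0"
  shows "reflect_poly (1 - monom 1 d :: int poly) = - (1 - monom 1 d)"
  using assms by (auto simp: poly_eq_iff coeff_reflect_poly degree_one_minus_monom)

lemma reflect_fib_poly: "reflect_poly (fib_poly k) = (-1) ^ k * fib_poly k"
proof (induction k)
  case (Suc k)
  have "fib_poly (Suc k) = fib_poly k * (1 - monom 1 (fib (k + 2)))"
    by (simp add: fib_poly_def)
  moreover have "reflect_poly (1 - monom 1 (fib (k + 2)) :: int poly) = - (1 - monom 1 (fib (k + 2)))"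
    by (intro reflect_poly_one_minus_monom fib_neq_0_nat) simp
  ultimately show ?case
    by (simp only: reflect_poly_mult Suc.IH) (simp add: algebra_simps)
qed (simp add: fib_poly_def)

lemma degree_fib_poly: "degree (fib_poly k) = fib (k + 3) - 2"
proof (induction k)
  case (Suc k)
  have "degree (fib_poly (Suc k)) = degree (fib_poly k) + fib (k + 2)"
  proof -
    have "coeff (1 - monom 1 (fib (i + 2)) :: int poly) 0 \<noteq> 0" for i
      by (simp add: fib_neq_0_nat)
    then have "1 - monom 1 (fib (i + 2)) \<noteq> (0 :: int poly)" for i
      by (metis coeff_0)
    then have "degree (fib_poly (Suc k)) =
        degree (fib_poly k) + degree (1 - monom 1 (fib (k + 2)) :: int poly)"
      by (simp add: fib_poly_def degree_mult_eq)
    then show ?thesis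
      by (simp add: degree_one_minus_monom fib_neq_0_nat)
  qed
  moreover have "fib (k + 3) \<ge> 2"
    by (induction k) (simp_all add: numeral_eq_Suc)
  ultimately show ?case
    using Suc by (simp add: numeral_eq_Suc)
qed (simp add: fib_poly_def numeral_eq_Suc)

text \<open>
  Stated through a sum of indices rather than a subtraction, so that both indices are
  automatically at most the degree \<open>fib (k + 3) - 2\<close>.
\<close>
lemma coeff_fib_poly_symmetric:
  assumes "i + j + 2 = fib (k + 3)"
  shows "coeff (fib_poly k) i = (-1) ^ k * coeff (fib_poly k) j"
proof -
  have "j \<le> degree (fib_poly k)" "degree (fib_poly k) - j = i"
    using assms by (simp_all add: degree_fib_poly)
  then have "coeff (reflect_poly (fib_poly k)) j = coeff (fib_poly k) i"
    by (simp add: coeff_reflect_poly)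
  moreover have "coeff ((-1) ^ k * p) j = (-1) ^ k * coeff p j" for p :: "int poly"
    by (cases "even k") simp_all
  ultimately show ?thesis
    by (simp add: reflect_fib_poly)
qed

text \<open>
  The factors beyond the first \<open>k\<close> are \<open>1 - x\<^sup>d\<close> with \<open>d \<ge> fib (k + 2)\<close>, so
  they leave the lower coefficients alone; and convergence of formal power series means that
  every coefficient is eventually constant.
\<close>
lemma acoeff_eq_coeff_fib_poly:
  assumes "m < fib (k + 2)"
  shows "acoeff m = coeff (fib_poly k) m"
proof -
  let ?f = "\<lambda>i. 1 - fps_X ^ fib (i + 2) :: int fps"
  have partial: "(\<Prod>i\<le>n. ?f i) = fps_of_poly (fib_poly (Suc n))" for n
    by (simp only: fib_poly_def fps_of_poly_prod fps_of_poly_diff fps_of_poly_monom'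
        fps_of_poly_1 lessThan_Suc_atMost)
  \<comment> \<open>No factor vanishes, so the product is a limit of the partial products from index 0 on.\<close>
  have "fps_nth (?f i) 0 \<noteq> 0" for i
    by (simp add: fib_neq_0_nat)
  then have "?f i \<noteq> 0" for i
    by (metis fps_zero_nth)
  then have "raw_has_prod ?f 0 fib_prod"
    using fib_prod_has_prod unfolding has_prod_def by metis
  then have "(\<lambda>n. fps_of_poly (fib_poly (Suc n))) \<longlonglongrightarrow> fib_prod"
    by (simp only: raw_has_prod_def partial add_0_right)
  then have "\<forall>\<^sub>F n in sequentially. coeff (fib_poly (Suc n)) m = acoeff m"
    by (simp add: tendsto_fps_iff acoeff_def)
  then obtain N where N: "\<And>n. n \<ge> N \<Longrightarrow> coeff (fib_poly (Suc n)) m = acoeff m"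
    by (auto simp: eventually_sequentially)
  have "coeff (fib_poly n) m = coeff (fib_poly k) m" if "k \<le> n" for n
    using that
  proof (induction n rule: dec_induct)
    case (step n)
    have "m < fib (n + 2)"
      using assms step(1) fib_mono[of "k + 2" "n + 2"] by linarith
    with step.IH show ?case
      by (simp add: coeff_fib_poly_Suc)
  qed simp
  from this[of "Suc (max k N)"] N[of "max k N"] show ?thesis
    by simp
qed

lemma acoeff_symmetric:
  assumes "i + j + 2 = fib (k + 3)" "i < fib (k + 2)" "j < fib (k + 2)"
  shows "acoeff i = (-1) ^ k * acoeff j"
  using assms by (simp add: acoeff_eq_coeff_fib_poly coeff_fib_poly_symmetric)

text \<open>
  This is \<open>a(N - 2 - j)\<close> under the convention that \<open>a\<close> vanishes at negative arguments,
  which truncated subtraction would not respect.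
\<close>
definition acoeff_reflected :: "nat \<Rightarrow> nat \<Rightarrow> int" where
  "acoeff_reflected N j = (if j + 2 \<le> N then acoeff (N - 2 - j) else 0)"

text \<open>
  The recurrence of the introduction, with \<open>n = k + 3\<close>. The coefficient of
  \<open>A\<^bsub>n-1\<^esub>\<close> at \<open>F\<^sub>n + j\<close> lies beyond the range where it agrees with \<open>a\<close>, but
  the mirror image \<open>F\<^bsub>n-1\<^esub> - 2 - j\<close> of this index lies within it; if the mirror image is negative, the original
  index exceeds the degree.
\<close>
lemma acoeff_fib_add:
  assumes "j < fib (k + 2)"
  shows "acoeff (fib (k + 3) + j) = (-1) ^ Suc k * acoeff_reflected (fib (k + 2)) j - acoeff j"
proof -
  have rec: "fib (k + 4) = fib (k + 3) + fib (k + 2)"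
    by (simp add: numeral_eq_Suc)
  have "acoeff (fib (k + 3) + j) = coeff (fib_poly (Suc (Suc k))) (fib (k + 3) + j)"
    using assms rec by (intro acoeff_eq_coeff_fib_poly) (simp add: numeral_eq_Suc)
  also have "\<dots> = coeff (fib_poly (Suc k)) (fib (k + 3) + j) - coeff (fib_poly (Suc k)) j"
    by (simp add: coeff_fib_poly_Suc[of "Suc k"] numeral_eq_Suc)
  also have "coeff (fib_poly (Suc k)) j = acoeff j"
    using assms fib_mono[of "k + 2" "Suc k + 2"]
    by (intro acoeff_eq_coeff_fib_poly[symmetric]) linarith
  also have "coeff (fib_poly (Suc k)) (fib (k + 3) + j) =
      (-1) ^ Suc k * acoeff_reflected (fib (k + 2)) j"
  proof (cases "j + 2 \<le> fib (k + 2)")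
    case True
    let ?i = "fib (k + 2) - 2 - j"
    have "coeff (fib_poly (Suc k)) (fib (k + 3) + j) =
        (-1) ^ Suc k * coeff (fib_poly (Suc k)) ?i"
    proof (rule coeff_fib_poly_symmetric)
      have "Suc k + 3 = k + 4" by simp
      then show "fib (k + 3) + j + ?i + 2 = fib (Suc k + 3)"
        using True rec by (simp only:)
    qed
    also have "coeff (fib_poly (Suc k)) ?i = acoeff ?i"
      using True fib_mono[of "k + 2" "Suc k + 2"]
      by (intro acoeff_eq_coeff_fib_poly[symmetric]) linarith
    finally show ?thesis
      using True by (simp add: acoeff_reflected_def)
  next
    case False
    have "Suc k + 3 = k + 4" by simp
    moreover have "fib (k + 3) > 0" by (intro fib_neq_0_nat) simp
    ultimately have "degree (fib_poly (Suc k)) < fib (k + 3) + j"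
      using False rec by (simp only: degree_fib_poly)
    with False show ?thesis
      by (simp add: acoeff_reflected_def coeff_eq_0)
  qed
  finally show ?thesis .
qed

theorem proposition1:
  fixes n :: nat
  assumes "n \<ge> 5"
  defines "I\<^sub>1 \<equiv> {fib n .. fib n + fib (n - 3) - 2}"
      and "I\<^sub>2 \<equiv> {fib n + fib (n - 3) - 1 .. fib n + fib (n - 2) - 1}"
      and "I\<^sub>3 \<equiv> {fib n + fib (n - 2) .. fib (n + 1) - 1}"
  shows "({fib n ..< fib (n + 1)} = I\<^sub>1 \<union> I\<^sub>2 \<union> I\<^sub>3 \<and>
            I\<^sub>1 \<inter> I\<^sub>2 = {} \<and> I\<^sub>1 \<inter> I\<^sub>3 = {} \<and> I\<^sub>2 \<inter> I\<^sub>3 = {} \<and> (n = 5 \<longrightarrow> I\<^sub>1 = {})) \<and>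
         (\<forall>j::nat. int j \<le> int (fib (n - 3)) - 2 \<longrightarrow>
            acoeff (fib n + j) = (-1) ^ (n - 1) * acoeff (fib (n - 3) - 2 - j)) \<and>
         (\<forall>m\<in>I\<^sub>2. acoeff m = 0) \<and>
         (\<forall>j::nat. j \<le> fib (n - 3) - 1 \<longrightarrow>
            acoeff (fib n + fib (n - 2) + j) = acoeff j)"
proof -
  obtain k where n: "n = k + 5"
    using assms(1) by (metis add.commute le_Suc_ex)
  define p where "p = fib (k + 2)"
  define q where "q = fib (k + 3)"
  have fibs: "fib (n - 3) = p" "fib (n - 2) = q" "fib (k + 4) = q + p"
      "fib n = q + p + q" "fib (n + 1) = q + p + q + (q + p)"
    by (simp_all add: n p_def q_def numeral_eq_Suc)
  have p: "1 \<le> p"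
    unfolding p_def by (simp add: Suc_leI fib_neq_0_nat)
  have pq: "p \<le> q"
    unfolding p_def q_def by (intro fib_mono) simp
  have sign: "(-1 :: int) ^ (n - 1) = (-1) ^ k" "(-1 :: int) ^ Suc (k + 2) = - ((-1) ^ k)"
    by (simp_all add: n uminus_power_if)
  \<comment> \<open>The recurrence for \<open>n - 2\<close> and for \<open>n\<close>; both carry the same sign.\<close>
  have low: "acoeff (q + j) = - ((-1) ^ k) * acoeff_reflected p j - acoeff j" if "j < p" for j
    using acoeff_fib_add[of j k] that by (simp add: p_def q_def)
  have high: "acoeff (fib n + j) = - ((-1) ^ k) * acoeff_reflected (q + p) j - acoeff j"
    if "j < q + p" for j
  proof -
    have "k + 2 + 2 = k + 4" "k + 2 + 3 = n"
      by (simp_all add: n)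
    then show ?thesis
      using acoeff_fib_add[of j "k + 2"] that by (simp only: fibs(3) sign(2))
  qed
  have sq: "(-1 :: int) ^ k * ((-1) ^ k * x) = x" for x
    by (cases "even k") simp_all

  have "{fib n ..< fib (n + 1)} = I\<^sub>1 \<union> I\<^sub>2 \<union> I\<^sub>3"
       "I\<^sub>1 \<inter> I\<^sub>2 = {}" "I\<^sub>1 \<inter> I\<^sub>3 = {}" "I\<^sub>2 \<inter> I\<^sub>3 = {}"
    unfolding I\<^sub>1_def I\<^sub>2_def I\<^sub>3_def fibs using p pq by auto
  moreover have "n = 5 \<longrightarrow> I\<^sub>1 = {}"
    by (auto simp: I\<^sub>1_def numeral_eq_Suc)
  moreover have "acoeff (fib n + j) = (-1) ^ (n - 1) * acoeff (fib (n - 3) - 2 - j)"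
    if "int j \<le> int (fib (n - 3)) - 2" for j
  proof -
    have j: "j + 2 \<le> p"
      using that fibs by linarith
    have twice: "p - 2 - j + 2 \<le> p" "p - 2 - (p - 2 - j) = j" "p - 2 - j < p"
      using j by linarith+
    have "acoeff_reflected (q + p) j = acoeff (q + (p - 2 - j))"
      using j by (simp add: acoeff_reflected_def add.commute)
    also have "\<dots> = - ((-1) ^ k) * acoeff j - acoeff (p - 2 - j)"
      using low[of "p - 2 - j"] twice by (simp only: acoeff_reflected_def if_True)
    finally show ?thesis
      unfolding sign(1) using high[of j] j by (simp add: fibs right_diff_distrib sq)
  qed
  moreover have "acoeff m = 0" if "m \<in> I\<^sub>2" for m
  proof -
    define j where "j = m - fib n"
    have j: "m = fib n + j" "p \<le> Suc j" "j < q"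
      using that p pq unfolding I\<^sub>2_def j_def fibs by auto
    \<comment> \<open>\<open>j\<close> and its mirror image add up to the degree of the product \<open>A\<^bsub>n-3\<^esub>\<close>.\<close>
    have "acoeff j = (-1) ^ Suc k * acoeff (q + p - 2 - j)"
    proof (rule acoeff_symmetric)
      show "j + (q + p - 2 - j) + 2 = fib (Suc k + 3)" "q + p - 2 - j < fib (Suc k + 2)"
        "j < fib (Suc k + 2)"
        using j p pq fibs(3) by (simp_all add: q_def numeral_eq_Suc)
    qed
    with high[of j] j p pq show ?thesis
      by (simp add: acoeff_reflected_def)
  qed
  moreover have "acoeff (fib n + fib (n - 2) + j) = acoeff j" if "j \<le> fib (n - 3) - 1" for j
  proof -
    have j: "j < p"
      using that p by (simp add: fibs)
    have "acoeff_reflected (q + p) (q + j) = acoeff_reflected p j"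
      by (simp add: acoeff_reflected_def)
    with high[of "q + j"] low[of j] j show ?thesis
      by (simp add: fibs add.assoc)
  qed
  ultimately show ?thesis
    by blast
qed

end
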